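(* Let $\alpha\ge 0$, let $\mu$ be a Borel probability measure on $\mathbb{R}^d$ that is occasionally-$\alpha$-dimensional, and suppose $\nu$ is a Bessel measure for $\mu$. Then $\mathcal{D}_\alpha(\nu)<\infty$, and so $\dim\nu\le\alpha$.
   Context: A Borel measure $\mu$ on $\mathbb{R}^d$ is occasionally-$\alpha$-dimensional if there exist a sequence of Borel subsets $E_n$ ($n\ge 0$) and constants $c_1,c_2>0$ such that $\operatorname{diam}(E_n)$ decreases to $0$ as $n\to\infty$, $\sup_n \frac{\operatorname{diam}(E_n)}{\operatorname{diam}(E_{n+1})}<\infty$, and $c_1\operatorname{diam}(E_n)^\alpha\le\mu(E_n)\le c_2\operatorname{diam}(E_n)^\alpha$ for all $n\ge 0$ (diameters are understood to be positive). For $f\in L^1(\mu)$, put $\widehat{f\,d\mu}(t)=\int f(x)e^{-2\pi i t\cdot x}\,d\mu(x)$, $t\in\mathbb{R}^d$. A (nonnegative) Borel measure $\nu$ on $\mathbb{R}^d$ is a Bessel measure for $\mu$ if there is a constant $B>0$ such that $\|\widehat{f\,d\mu}\|_{L^2(\nu)}^2\le B\|f\|_{L^2(\mu)}^2$ for every $f\in L^2(\mu)$. With $Q=[0,1)^d$ and $\alpha\ge 0$, $\mathcal{D}_\alpha(\nu)=\limsup_{R\to\infty}\sup_{x\in\mathbb{R}^d}\frac{\nu(x+RQ)}{R^\alpha}$ is the $\alpha$-upper Beurling density, and $\dim\nu=\sup\{\alpha\ge 0:\mathcal{D}_\alpha(\nu)=\infty\}$ (with $\sup\emptyset=0$) is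 the (upper) Beurling dimension. *)

theory Defs
  imports "HOL-Probability.Probability"
begin

text \<open>
  Borel measures on \<open>\<real>\<^sup>d\<close> are measures \<open>M :: (real ^ 'd) measure\<close> with \<open>sets M = sets borel\<close>.
\<close>

text \<open>
  The library's \<^const>\<open>diameter\<close> is \<open>0\<close> on unbounded sets, so boundedness of the sets \<open>E n\<close>
  is required explicitly; in the mathematical definition it follows from the finiteness of the
  supremum of the ratios. The diameters decrease in the weak sense.
\<close>

definition occasionally_dimensional :: "real \<Rightarrow> (real ^ 'd) measure \<Rightarrow> bool" where
  "occasionally_dimensional \<alpha> \<mu> \<longleftrightarrow>
     (\<exists>(E :: nat \<Rightarrow> (real ^ 'd) set) c\<^sub>1 c\<^sub>2. c\<^sub>1 > 0 \<and> c\<^sub>2 > 0 \<and>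
        (\<forall>n. E n \<in> sets borel \<and> bounded (E n) \<and> diameter (E n) > 0) \<and>
        decseq (\<lambda>n. diameter (E n)) \<and>
        (\<lambda>n. diameter (E n)) \<longlonglongrightarrow> 0 \<and>
        bdd_above (range (\<lambda>n. diameter (E n) / diameter (E (Suc n)))) \<and>
        (\<forall>n. ennreal (c\<^sub>1 * diameter (E n) powr \<alpha>) \<le> emeasure \<mu> (E n) \<and>
             emeasure \<mu> (E n) \<le> ennreal (c\<^sub>2 * diameter (E n) powr \<alpha>)))"

definition fourier_transform ::
    "(real ^ 'd) measure \<Rightarrow> (real ^ 'd \<Rightarrow> complex) \<Rightarrow> real ^ 'd \<Rightarrow> complex" where
  "fourier_transform \<mu> f t =
     (LINT x|\<mu>. f x * exp (- (2 * complex_of_real pi * \<i> * complex_of_real (t \<bullet> x))))"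

definition square_integrable :: "'a measure \<Rightarrow> ('a \<Rightarrow> complex) \<Rightarrow> bool" where
  "square_integrable M f \<longleftrightarrow>
     f \<in> borel_measurable M \<and> integrable M (\<lambda>x. (cmod (f x))\<^sup>2)"

text \<open>
  The notion is meant for finite \<open>\<mu>\<close>, where \<open>L\<^sup>2(\<mu>) \<subseteq> L\<^sup>1(\<mu>)\<close>, so that the transform
  is defined by a convergent integral. The norm in \<open>L\<^sup>2(\<nu>)\<close> is an extended nonnegative integral,
  so its finiteness is part of the inequality.
\<close>

definition bessel_measure :: "(real ^ 'd) measure \<Rightarrow> (real ^ 'd) measure \<Rightarrow> bool" where
  "bessel_measure \<nu> \<mu> \<longleftrightarrow>
     (\<exists>B>0. \<forall>f. square_integrable \<mu> f \<longrightarrow>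
        (\<integral>\<^sup>+t. ennreal ((cmod (fourier_transform \<mu> f t))\<^sup>2) \<partial>\<nu>)
          \<le> ennreal (B * (LINT x|\<mu>. (cmod (f x))\<^sup>2)))"

definition unit_cube :: "(real ^ 'd) set" where
  "unit_cube = {q. \<forall>i. 0 \<le> q $ i \<and> q $ i < 1}"

definition beurling_density :: "real \<Rightarrow> (real ^ 'd) measure \<Rightarrow> ennreal" where
  "beurling_density \<alpha> \<nu> =
     Limsup at_top (\<lambda>R::real.
       SUP x. emeasure \<nu> ((\<lambda>q. x + R *\<^sub>R q) ` unit_cube) / ennreal (R powr \<alpha>))"

text \<open>In \<^typ>\<open>ennreal\<close> the supremum of the empty set is \<open>0\<close>.\<close>

definition beurling_dim :: "(real ^ 'd) measure \<Rightarrow> ennreal" where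
  "beurling_dim \<nu> = Sup (ennreal ` {\<alpha>. \<alpha> \<ge> 0 \<and> beurling_density \<alpha> \<nu> = \<infinity>})"

end

theory Submission
  imports Defs
begin

text \<open>
  The uncertainty principle is at work. If \<open>E\<close> has diameter \<open>\<delta>\<close>, then for frequencies \<open>t\<close> at
  distance at most \<open>1 / (2\<pi>\<delta>)\<close> from a given \<open>s\<close> the character \<open>x \<mapsto> exp (-2\<pi>i (t - s) \<bullet> x)\<close>
  turns by at most one radian over \<open>E\<close>. The transform of the modulated indicator
  \<open>1\<^sub>E(x) exp (2\<pi>i s \<bullet> x)\<close> is therefore at least \<open>\<mu>(E) / 2\<close> in modulus on the whole ball of radius
  \<open>1 / (2\<pi>\<delta>)\<close> about \<open>s\<close>. Testing the Bessel inequality with this function bounds the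
  \<open>\<nu>\<close>-measure of the ball by \<open>4B / \<mu>(E)\<close>, uniformly in \<open>s\<close> (lemma \<open>bessel_emeasure_cball_le\<close>).

  For a cube of large side \<open>R\<close>, apply this to a set \<open>E\<^sub>n\<close> with diameter comparable to \<open>1/R\<close>. It
  exists because the diameters tend to \<open>0\<close> without dropping by more than a bounded factor in
  one step (lemma \<open>slowly_vanishing_hits_scale\<close>). Since \<open>\<mu>(E\<^sub>n)\<close> is at least a constant times
  \<open>diam(E\<^sub>n)\<^sup>\<alpha>\<close>, hence a constant times \<open>R\<^sup>-\<^sup>\<alpha>\<close>, the cube has \<open>\<nu>\<close>-measure \<open>O(R\<^sup>\<alpha>)\<close>. The bound on
  the dimension follows because the density does not increase with the exponent.
\<close>

section \<open>Bessel bounds on balls\<close>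

lemma cos_ge_half:
  fixes y :: real
  assumes "\<bar>y\<bar> \<le> 1"
  shows "1 / 2 \<le> cos y"
proof -
  have "cos (pi / 3) \<le> cos \<bar>y\<bar>"
    by (rule cos_monotone_0_pi_le) (use assms pi_gt3 in auto)
  then show ?thesis
    by (simp add: cos_60)
qed

text \<open>
  Factoring out the phase at a point of \<open>E\<close> does not change the modulus of the transform and
  leaves an integrand of real part at least \<open>1/2\<close>.
\<close>

lemma fourier_transform_modulated_indicator_ge:
  fixes \<mu> :: "(real ^ 'd) measure" and s t :: "real ^ 'd"
  assumes fin: "finite_measure \<mu>" and sets: "sets \<mu> = sets borel"
    and E: "E \<in> sets borel" "bounded E"
    and close: "2 * pi * norm (t - s) * diameter E \<le> 1"
  shows "measure \<mu> E / 2
     \<le> cmod (fourier_transform \<mu>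
          (\<lambda>x. indicator E x * exp (2 * complex_of_real pi * \<i> * complex_of_real (s \<bullet> x))) t)"
proof (cases "E = {}")
  case True
  then show ?thesis by simp
next
  case False
  interpret finite_measure \<mu> by (rule fin)
  from False obtain x0 where x0: "x0 \<in> E" by blast
  define g where "g = (\<lambda>x. indicator E x * cis (- (2 * pi * ((t - s) \<bullet> (x - x0)))))"
  define u where "u = cis (- (2 * pi * ((t - s) \<bullet> x0)))"
  have meas: "g \<in> borel_measurable \<mu>"
    unfolding g_def cis_conv_exp measurable_cong_sets[OF sets refl] using E(1) by measurable
  have int: "integrable \<mu> g"
    by (rule integrable_const_bound[where B = 1])
       (use meas in \<open>auto simp: g_def norm_mult indicator_def\<close>)
  have factor:
    "indicator E x * exp (2 * complex_of_real pi * \<i> * complex_of_real (s \<bullet> x))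
       * exp (- (2 * complex_of_real pi * \<i> * complex_of_real (t \<bullet> x))) = u * g x" for x
  proof -
    have "exp (2 * complex_of_real pi * \<i> * complex_of_real (s \<bullet> x))
       * exp (- (2 * complex_of_real pi * \<i> * complex_of_real (t \<bullet> x)))
       = cis (2 * pi * (s \<bullet> x)) * cis (- (2 * pi * (t \<bullet> x)))"
      by (simp add: cis_conv_exp mult_ac)
    also have "\<dots> = u * cis (- (2 * pi * ((t - s) \<bullet> (x - x0))))"
      unfolding u_def by (simp add: cis_mult algebra_simps inner_diff_left inner_diff_right)
    finally show ?thesis
      by (simp add: g_def mult_ac)
  qed
  have Re_g: "indicator E x / 2 \<le> Re (g x)" for x
  proof (cases "x \<in> E")
    case True
    have "\<bar>(t - s) \<bullet> (x - x0)\<bar> \<le> norm (t - s) * norm (x - x0)"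
      by (rule Cauchy_Schwarz_ineq2)
    also have "\<dots> \<le> norm (t - s) * diameter E"
      using diameter_bounded_bound[OF E(2) True x0] by (intro mult_left_mono) (auto simp: dist_norm)
    finally have "2 * pi * \<bar>(t - s) \<bullet> (x - x0)\<bar> \<le> 2 * pi * (norm (t - s) * diameter E)"
      by (rule mult_left_mono) simp
    also have "\<dots> \<le> 1"
      using close by (simp only: mult.assoc)
    finally have "\<bar>2 * pi * ((t - s) \<bullet> (x - x0))\<bar> \<le> 1"
      by (simp add: abs_mult)
    from cos_ge_half[OF this] True show ?thesis
      by (simp add: g_def)
  qed (simp add: g_def)
  have "measure \<mu> E / 2 = (LINT x|\<mu>. indicator E x / 2)"
    using E(1) sets sets_eq_imp_space_eq[OF sets] by simp
  also have "\<dots> \<le> (LINT x|\<mu>. Re (g x))"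
  proof (rule integral_mono)
    show "integrable \<mu> (\<lambda>x. indicator E x / (2::real))"
      using E(1) sets by (intro integrable_divide integrable_real_indicator) (auto simp: less_top[symmetric])
    show "integrable \<mu> (\<lambda>x. Re (g x))"
      using int by simp
  qed (rule Re_g)
  also have "\<dots> = Re (integral\<^sup>L \<mu> g)"
    using int by simp
  also have "\<dots> \<le> cmod (integral\<^sup>L \<mu> g)"
    by (rule complex_Re_le_cmod)
  also have "\<dots> = cmod (LINT x|\<mu>. u * g x)"
    by (simp add: norm_mult u_def)
  finally show ?thesis
    unfolding fourier_transform_def factor .
qed

text \<open>
  The Bessel inequality is tested with the modulated indicator of \<open>E\<close>, whose squared norm in
  \<open>L\<^sup>2(\<mu>)\<close> is \<open>\<mu>(E)\<close> while its squared transform is at least \<open>\<mu>(E)\<^sup>2 / 4\<close> on the ball.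
\<close>

lemma bessel_emeasure_cball_le:
  fixes \<mu> \<nu> :: "(real ^ 'd) measure"
  assumes fin: "finite_measure \<mu>" and sets: "sets \<mu> = sets borel" "sets \<nu> = sets borel"
    and bessel: "\<And>f. square_integrable \<mu> f \<Longrightarrow>
        (\<integral>\<^sup>+t. ennreal ((cmod (fourier_transform \<mu> f t))\<^sup>2) \<partial>\<nu>)
          \<le> ennreal (B * (LINT x|\<mu>. (cmod (f x))\<^sup>2))"
    and E: "E \<in> sets borel" "bounded E" "0 < measure \<mu> E"
    and L: "2 * pi * L * diameter E \<le> 1"
  shows "emeasure \<nu> (cball s L) \<le> ennreal (4 * B / measure \<mu> E)"
proof -
  interpret finite_measure \<mu> by (rule fin)
  define m where "m = measure \<mu> E"
  have m: "0 < m" using E(3) by (simp add: m_def)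
  define f where
    "f = (\<lambda>x. indicator E x * exp (2 * complex_of_real pi * \<i> * complex_of_real (s \<bullet> x)))"
  have f_norm: "(cmod (f x))\<^sup>2 = indicator E x" for x
    by (simp add: f_def norm_mult indicator_def)
  have "f \<in> borel_measurable \<mu>"
    unfolding f_def measurable_cong_sets[OF sets(1) refl] using E(1) by measurable
  then have "square_integrable \<mu> f"
    unfolding square_integrable_def f_norm
    using E(1) sets by (auto intro!: integrable_real_indicator simp: less_top[symmetric])
  note test = bessel[OF this]
  have "emeasure \<nu> (cball s L) * ennreal ((m / 2)\<^sup>2)
      = (\<integral>\<^sup>+t. ennreal ((m / 2)\<^sup>2) * indicator (cball s L) t \<partial>\<nu>)"
    using sets by (subst nn_integral_cmult_indicator) (auto simp: mult.commute)
  also have "\<dots> \<le> (\<integral>\<^sup>+t. ennreal ((cmod (fourier_transform \<mu> f t))\<^sup>2) \<partial>\<nu>)"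
  proof (rule nn_integral_mono)
    fix t
    show "ennreal ((m / 2)\<^sup>2) * indicator (cball s L) t
        \<le> ennreal ((cmod (fourier_transform \<mu> f t))\<^sup>2)"
    proof (cases "t \<in> cball s L")
      case True
      then have "norm (t - s) * diameter E \<le> L * diameter E"
        using diameter_ge_0[OF E(2)]
        by (intro mult_right_mono) (auto simp: dist_norm norm_minus_commute)
      then have "2 * pi * (norm (t - s) * diameter E) \<le> 2 * pi * (L * diameter E)"
        by (rule mult_left_mono) simp
      also have "\<dots> \<le> 1"
        using L by (simp only: mult.assoc)
      finally have "2 * pi * norm (t - s) * diameter E \<le> 1"
        by (simp only: mult.assoc)
      from fourier_transform_modulated_indicator_ge[OF fin sets(1) E(1,2) this]
      have "m / 2 \<le> cmod (fourier_transform \<mu> f t)"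
        by (simp add: f_def m_def)
      with m True show ?thesis
        by (auto intro!: ennreal_leI power_mono)
    qed simp
  qed
  also have "\<dots> \<le> ennreal (B * m)"
    using test E(1) sets sets_eq_imp_space_eq[OF sets(1)] by (simp add: f_norm m_def)
  finally have *: "emeasure \<nu> (cball s L) * ennreal ((m / 2)\<^sup>2) \<le> ennreal (B * m)" .
  have "emeasure \<nu> (cball s L)
      = emeasure \<nu> (cball s L) * ennreal ((m / 2)\<^sup>2) * ennreal (1 / (m / 2)\<^sup>2)"
    using m by (simp add: mult.assoc flip: ennreal_mult)
  also have "\<dots> \<le> ennreal (B * m) * ennreal (1 / (m / 2)\<^sup>2)"
    by (intro mult_right_mono * ) simp
  also have "\<dots> = ennreal (B * m * (1 / (m / 2)\<^sup>2))"
    by (rule ennreal_mult''[symmetric]) simp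
  also have "B * m * (1 / (m / 2)\<^sup>2) = 4 * B / m"
    using m by (simp add: field_simps power2_eq_square)
  finally show ?thesis
    by (simp add: m_def)
qed

section \<open>Finiteness of the Beurling density\<close>

text \<open>
  At the first index with \<open>\<delta> n \<le> \<epsilon>\<close> the preceding term still exceeds \<open>\<epsilon>\<close>, and a single step
  loses at most the factor \<open>K\<close>.
\<close>

lemma slowly_vanishing_hits_scale:
  fixes \<delta> :: "nat \<Rightarrow> real"
  assumes lim: "\<delta> \<longlonglongrightarrow> 0"
    and pos: "\<And>n. 0 < \<delta> n"
    and ratio: "\<And>n. \<delta> n / \<delta> (Suc n) \<le> K"
    and \<epsilon>: "0 < \<epsilon>" "\<epsilon> < \<delta> 0"
  obtains n where "\<delta> n \<le> \<epsilon>" "\<epsilon> \<le> K * \<delta> n"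
proof -
  have ex: "\<exists>n. \<delta> n \<le> \<epsilon>"
    using order_tendstoD(2)[OF lim \<epsilon>(1)] unfolding eventually_sequentially
    by (meson less_imp_le order_refl)
  define n where "n = (LEAST n. \<delta> n \<le> \<epsilon>)"
  have n: "\<delta> n \<le> \<epsilon>"
    unfolding n_def using ex by (rule LeastI_ex)
  with \<epsilon>(2) obtain k where k: "n = Suc k"
    by (cases n) auto
  have "\<not> \<delta> k \<le> \<epsilon>"
    by (rule not_less_Least) (simp add: n_def[symmetric] k)
  with ratio[of k] pos[of n] have "\<epsilon> \<le> K * \<delta> n"
    by (simp add: k divide_le_eq)
  with n show thesis by (rule that)
qed

lemma cube_subset_cball:
  fixes x :: "real ^ 'd"
  assumes "0 \<le> R"
  shows "(\<lambda>q. x + R *\<^sub>R q) ` unit_cube \<subseteq> cball x (R * real CARD('d))"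
proof safe
  fix q :: "real ^ 'd"
  assume "q \<in> unit_cube"
  then have q: "\<bar>q $ i\<bar> \<le> 1" for i
    by (auto simp: unit_cube_def abs_le_iff intro: less_imp_le order.trans[of _ 0])
  have "norm q \<le> (\<Sum>i\<in>UNIV. \<bar>q $ i\<bar>)"
    by (rule norm_le_l1_cart)
  also have "\<dots> \<le> real CARD('d)"
    using sum_bounded_above[of UNIV "\<lambda>i. \<bar>q $ i\<bar>" 1] q by simp
  finally have "R * norm q \<le> R * real CARD('d)"
    using assms by (rule mult_left_mono)
  then show "x + R *\<^sub>R q \<in> cball x (R * real CARD('d))"
    using assms by (simp add: dist_norm)
qed

theorem bessel_beurling_density_finite:
  fixes \<alpha> :: real and \<mu> \<nu> :: "(real ^ 'd) measure"
  assumes \<alpha>: "\<alpha> \<ge> 0"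
    and fin: "finite_measure \<mu>" and sets: "sets \<mu> = sets borel" "sets \<nu> = sets borel"
    and occ: "occasionally_dimensional \<alpha> \<mu>"
    and bes: "bessel_measure \<nu> \<mu>"
  shows "beurling_density \<alpha> \<nu> < \<infinity>"
proof -
  interpret finite_measure \<mu> by (rule fin)
  from bes obtain B where B: "0 < B"
    and bessel: "\<And>f. square_integrable \<mu> f \<Longrightarrow>
        (\<integral>\<^sup>+t. ennreal ((cmod (fourier_transform \<mu> f t))\<^sup>2) \<partial>\<nu>)
          \<le> ennreal (B * (LINT x|\<mu>. (cmod (f x))\<^sup>2))"
    unfolding bessel_measure_def by blast
  from occ obtain E c where c: "0 < c"
    and E: "\<And>n. E n \<in> sets borel" "\<And>n. bounded (E n)" "\<And>n. 0 < diameter (E n)"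
    and lim: "(\<lambda>n. diameter (E n)) \<longlonglongrightarrow> 0"
    and bdd: "bdd_above (range (\<lambda>n. diameter (E n) / diameter (E (Suc n))))"
    and low: "\<And>n. ennreal (c * diameter (E n) powr \<alpha>) \<le> emeasure \<mu> (E n)"
    unfolding occasionally_dimensional_def by blast
  from bdd obtain K where K: "\<And>n. diameter (E n) / diameter (E (Suc n)) \<le> K"
    unfolding bdd_above_def by auto
  have "0 < diameter (E 0) / diameter (E (Suc 0))"
    using E(3) by simp
  with K[of 0] have K_pos: "0 < K" by linarith
  have low': "c * diameter (E n) powr \<alpha> \<le> measure \<mu> (E n)" for n
    using low[of n] by (simp add: emeasure_eq_measure)
  \<comment> \<open>A cube of side \<open>R\<close> lies in a ball of radius \<open>R CARD('d)\<close>, so sets of diameter at most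
    \<open>1 / (a R)\<close> are the ones whose characters stay in phase over the whole cube.\<close>
  define a where "a = 2 * pi * real CARD('d)"
  have a: "0 < a" by (simp add: a_def)
  define C where "C = 4 * B / c * (a * K) powr \<alpha>"
  have cube: "emeasure \<nu> ((\<lambda>q. x + R *\<^sub>R q) ` unit_cube) / ennreal (R powr \<alpha>) \<le> ennreal C"
    if R: "1 / (a * diameter (E 0)) < R" for R x
  proof -
    have "0 < 1 / (a * diameter (E 0))"
      using a E(3) by simp
    with R have R_pos: "0 < R" by linarith
    have small: "1 / (a * R) < diameter (E 0)"
      using R R_pos a E(3)[of 0] by (simp add: field_simps)
    obtain n where n: "diameter (E n) \<le> 1 / (a * R)" "1 / (a * R) \<le> K * diameter (E n)"
      by (rule slowly_vanishing_hits_scale[OF lim E(3) K _ small]) (use a R_pos in auto)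
    have "1 / (a * K * R) \<le> diameter (E n)"
      using n(2) a R_pos K_pos by (simp add: field_simps)
    then have "(1 / (a * K * R)) powr \<alpha> \<le> diameter (E n) powr \<alpha>"
      using a K_pos R_pos \<alpha> by (intro powr_mono2) auto
    then have "c * (1 / (a * K * R)) powr \<alpha> \<le> c * diameter (E n) powr \<alpha>"
      using c by (intro mult_left_mono) auto
    also note low'[of n]
    finally have mE: "c / ((a * K) powr \<alpha> * R powr \<alpha>) \<le> measure \<mu> (E n)"
      using a K_pos R_pos by (simp add: powr_divide powr_mult)
    have lower_pos: "0 < c / ((a * K) powr \<alpha> * R powr \<alpha>)"
      using c a K_pos R_pos by simp
    have radius: "2 * pi * (R * real CARD('d)) * diameter (E n) \<le> 1"
      using n(1) a R_pos by (simp add: a_def field_simps)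
    have "emeasure \<nu> ((\<lambda>q. x + R *\<^sub>R q) ` unit_cube) \<le> emeasure \<nu> (cball x (R * real CARD('d)))"
      using R_pos sets by (intro emeasure_mono cube_subset_cball) auto
    also have "\<dots> \<le> ennreal (4 * B / measure \<mu> (E n))"
      by (rule bessel_emeasure_cball_le[OF fin sets bessel E(1,2) _ radius])
         (use mE lower_pos in auto)
    also have "\<dots> \<le> ennreal (4 * B / (c / ((a * K) powr \<alpha> * R powr \<alpha>)))"
      using mE lower_pos B
      by (intro ennreal_leI divide_left_mono mult_pos_pos less_le_trans[OF lower_pos mE]) auto
    also have "4 * B / (c / ((a * K) powr \<alpha> * R powr \<alpha>)) = C * R powr \<alpha>"
      by (simp add: C_def)
    finally have "emeasure \<nu> ((\<lambda>q. x + R *\<^sub>R q) ` unit_cube) / ennreal (R powr \<alpha>)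
        \<le> ennreal (C * R powr \<alpha>) / ennreal (R powr \<alpha>)"
      by (rule divide_right_mono_ennreal)
    also have "\<dots> = ennreal C"
      using R_pos B c by (subst divide_ennreal) (auto simp: C_def)
    finally show ?thesis .
  qed
  have "beurling_density \<alpha> \<nu> \<le> ennreal C"
    unfolding beurling_density_def
    by (intro Limsup_bounded eventually_mono[OF eventually_gt_at_top] SUP_least) (rule cube)
  also have "\<dots> < \<infinity>" by simp
  finally show ?thesis .
qed

section \<open>Density and dimension\<close>

lemma beurling_density_antimono:
  fixes \<nu> :: "(real ^ 'd) measure"
  assumes "\<alpha> \<le> \<beta>"
  shows "beurling_density \<beta> \<nu> \<le> beurling_density \<alpha> \<nu>"
  unfolding beurling_density_def
proof (intro Limsup_mono eventually_mono[OF eventually_ge_at_top[of 1]] SUP_mono')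
  fix R :: real and x :: "real ^ 'd"
  assume "1 \<le> R"
  with assms have "inverse (R powr \<beta>) \<le> inverse (R powr \<alpha>)"
    by (intro le_imp_inverse_le powr_mono) auto
  with \<open>1 \<le> R\<close> have "inverse (ennreal (R powr \<beta>)) \<le> inverse (ennreal (R powr \<alpha>))"
    by (simp add: inverse_ennreal ennreal_leI)
  then show "emeasure \<nu> ((\<lambda>q. x + R *\<^sub>R q) ` unit_cube) / ennreal (R powr \<beta>)
      \<le> emeasure \<nu> ((\<lambda>q. x + R *\<^sub>R q) ` unit_cube) / ennreal (R powr \<alpha>)"
    unfolding divide_ennreal_def by (rule mult_left_mono) simp
qed

lemma beurling_dim_le:
  fixes \<nu> :: "(real ^ 'd) measure"
  assumes "beurling_density \<alpha> \<nu> < \<infinity>"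
  shows "beurling_dim \<nu> \<le> ennreal \<alpha>"
  unfolding beurling_dim_def
proof (rule Sup_least, safe)
  fix \<beta> :: real
  assume "beurling_density \<beta> \<nu> = \<infinity>"
  with assms have "\<not> \<alpha> \<le> \<beta>"
    using beurling_density_antimono[of \<alpha> \<beta> \<nu>] by auto
  then show "ennreal \<beta> \<le> ennreal \<alpha>"
    by (intro ennreal_leI) simp
qed

theorem theorem3p8:
  fixes \<alpha> :: real and \<mu> \<nu> :: "(real ^ 'd) measure"
  assumes "\<alpha> \<ge> 0"
    and "prob_space \<mu>" and "sets \<mu> = sets borel"
    and "occasionally_dimensional \<alpha> \<mu>"
    and "sets \<nu> = sets borel"
    and "bessel_measure \<nu> \<mu>"
  shows "beurling_density \<alpha> \<nu> < \<infinity> \<and> beurling_dim \<nu> \<le> ennreal \<alpha>"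
proof -
  have "beurling_density \<alpha> \<nu> < \<infinity>"
    using assms by (intro bessel_beurling_density_finite prob_space.finite_measure)
  then show ?thesis
    by (simp add: beurling_dim_le)
qed

end
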